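(* Every Peano continuum $X$ admits an exact Devaney chaotic map, i.e. there exists a continuous map $f:X\to X$ such that (i) for every nonempty open set $U\subseteq X$ there exists $n\in\mathbb{N}$ with $f^n(U)=X$, and (ii) $f$ is Devaney chaotic, that is, $f$ is transitive and the set of periodic points of $f$ is dense in $X$.
   Context: A continuum is a compact connected metrizable topological space; a Peano continuum is a locally connected continuum. A continuous map $f:X\to X$ is transitive if for all nonempty open $U,V\subseteq X$ there is a natural number $n$ such that $f^n(U)\cap V\neq\emptyset$. Here $f^0=\mathrm{id}_X$ and $f^{n+1}=f\circ f^n$. *)

theory Defs
  imports "HOL-Analysis.Analysis"
begin

definition continuum :: "'a topology \<Rightarrow> bool" where
  "continuum X \<longleftrightarrow> compact_space X \<and> connected_space X \<and> metrizable_space X"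

definition peano_continuum :: "'a topology \<Rightarrow> bool" where
  "peano_continuum X \<longleftrightarrow> continuum X \<and> locally_connected_space X"

text \<open>
  A self-map of the space \<open>X\<close> is a total function on the underlying type with
  \<^term>\<open>continuous_map X X f\<close>; such a function preserves \<^term>\<open>topspace X\<close>, and its
  values outside \<^term>\<open>topspace X\<close> play no role below.
\<close>

definition transitive_map :: "'a topology \<Rightarrow> ('a \<Rightarrow> 'a) \<Rightarrow> bool" where
  "transitive_map X f \<longleftrightarrow> continuous_map X X f \<and>
     (\<forall>U V. openin X U \<and> U \<noteq> {} \<and> openin X V \<and> V \<noteq> {} \<longrightarrow>
        (\<exists>n. (f ^^ n) ` U \<inter> V \<noteq> {}))"

text \<open>Periods are positive, since every point is fixed by \<^term>\<open>f ^^ 0\<close>.\<close>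

definition periodic_points :: "'a topology \<Rightarrow> ('a \<Rightarrow> 'a) \<Rightarrow> 'a set" where
  "periodic_points X f = {x \<in> topspace X. \<exists>n>0. (f ^^ n) x = x}"

definition devaney_chaotic :: "'a topology \<Rightarrow> ('a \<Rightarrow> 'a) \<Rightarrow> bool" where
  "devaney_chaotic X f \<longleftrightarrow> transitive_map X f \<and>
     X closure_of (periodic_points X f) = topspace X"

definition exact_map :: "'a topology \<Rightarrow> ('a \<Rightarrow> 'a) \<Rightarrow> bool" where
  "exact_map X f \<longleftrightarrow> continuous_map X X f \<and>
     (\<forall>U. openin X U \<and> U \<noteq> {} \<longrightarrow> (\<exists>n. (f ^^ n) ` U = topspace X))"

end

theory Submission
  imports Defs "HOL-Complex_Analysis.Conformal_Mappings"
begin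

text \<open>
  If \<open>X\<close> has at most one point, the identity map works.  Otherwise \<open>f\<close> is taken to be a composition
  \<open>g \<circ> h\<close> of a continuous \<open>h : X \<rightarrow> [0,1]\<close> with a continuous surjection \<open>g : [0,1] \<rightarrow> X\<close>.  Then \<open>g\<close>
  intertwines \<open>f\<close> with the interval map \<open>F = h \<circ> g\<close>, that is \<open>f\<^sup>n \<circ> g = g \<circ> F\<^sup>n\<close>, and it suffices to
  make \<open>F\<close> expand.

  For each level \<open>n\<close> the unit interval is cut into \<open>N n\<close> equal cells.  The aim is that \<open>F\<close> maps
  every cell of level \<open>n + 1\<close> onto a set containing a cell of level \<open>n\<close>, and that \<open>g\<close> maps every cell
  of level \<open>0\<close> onto \<open>X\<close>.  A nonempty open \<open>U\<close> contains the \<open>g\<close>-image of some cell of some level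
  \<open>n\<close>; following it down the levels gives \<open>f\<^sup>n(U) = X\<close>.  One more application of \<open>h\<close> shows that
  \<open>F\<^sup>n\<^sup>+\<^sup>1\<close> maps this cell onto \<open>[0,1]\<close>, so \<open>F\<^sup>n\<^sup>+\<^sup>1\<close> has a fixed point in it, whose \<open>g\<close>-image is a
  periodic point of \<open>f\<close> in \<open>U\<close>.  Transitivity is immediate from exactness.  This is
  \<open>exact_devaney_if_cells_expand\<close>.

  The surjection \<open>g\<close> comes from a quantitative form of the Hahn-Mazurkiewicz theorem
  (\<open>cellwise_open_parametrization\<close>): there are radii \<open>\<delta> n > 0\<close> that depend on \<open>X\<close> alone such that, for
  every prescribed lower bound on the numbers \<open>N n\<close>, some \<open>g\<close> maps each cell of level \<open>n\<close> onto a set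
  containing a ball of radius \<open>\<delta> n\<close>.  It is a limit of finite walks in \<open>X\<close>; repeating points in a
  walk makes the number of cells as large as desired without changing the radii.

  The function \<open>h\<close> has to be onto \<open>[0,1]\<close> and nonconstant on every ball
  (\<open>exists_onto_unit_interval_nonconstant_on_balls\<close>).  By compactness there is then \<open>\<omega> n > 0\<close> such that
  \<open>h\<close> varies by at least \<open>\<omega> n\<close> on every ball of radius \<open>\<delta> (n + 1)\<close>.  Since \<open>\<delta>\<close> and \<open>h\<close>, and hence
  \<open>\<omega>\<close>, are known before \<open>g\<close> is built, one may ask for \<open>N n > 2 / \<omega> n\<close>: the \<open>F\<close>-image of a cell of
  level \<open>n + 1\<close> is then an interval of length at least two cells of level \<open>n\<close>, so it contains one.
\<close>

section \<open>Finite tours along a relation\<close>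

text \<open>
  The set to be visited is a parameter so that concatenating tours takes the union of these sets.
\<close>
definition tour :: "('a \<times> 'a) set \<Rightarrow> 'a \<Rightarrow> 'a \<Rightarrow> 'a set \<Rightarrow> bool" where
  "tour R x y Y \<longleftrightarrow>
     (\<exists>n p. p 0 = x \<and> p n = y \<and> (\<forall>i<n. (p i, p (Suc i)) \<in> R) \<and> Y \<subseteq> p ` {..n})"

lemma tour_append:
  assumes "tour R x y Y" and "tour R y z Z"
  shows "tour R x z (Y \<union> Z)"
proof -
  obtain n p where p: "p 0 = x" "p n = y" "\<forall>i<n. (p i, p (Suc i)) \<in> R" "Y \<subseteq> p ` {..n}"
    using assms(1) unfolding tour_def by blast
  obtain m q where q: "q 0 = y" "q m = z" "\<forall>i<m. (q i, q (Suc i)) \<in> R" "Z \<subseteq> q ` {..m}"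
    using assms(2) unfolding tour_def by blast
  define r where "r i = (if i \<le> n then p i else q (i - n))" for i
  have r: "r (n + i) = q i" for i
    using p(2) q(1) by (cases i) (auto simp: r_def)
  have "(r i, r (Suc i)) \<in> R" if "i < n + m" for i
  proof (cases "i < n")
    case True
    then show ?thesis using p(3) by (simp add: r_def)
  next
    case False
    then obtain j where "i = n + j" by (metis le_Suc_ex not_less)
    then show ?thesis using q(3) that r[of j] r[of "Suc j"] by auto
  qed
  moreover have "Y \<union> Z \<subseteq> r ` {..n + m}"
  proof -
    have "p i \<in> r ` {..n + m}" if "i \<le> n" for i
      using that by (intro image_eqI[of _ _ i]) (auto simp: r_def)
    moreover have "q i \<in> r ` {..n + m}" if "i \<le> m" for i
      using that r by (intro image_eqI[of _ _ "n + i"]) auto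
    ultimately show ?thesis using p(4) q(4) by blast
  qed
  moreover have "r 0 = x" "r (n + m) = z"
    using p(1) q(2) r by (auto simp: r_def)
  ultimately show ?thesis unfolding tour_def by blast
qed

lemma rtrancl_imp_tour:
  assumes "(x, y) \<in> R\<^sup>*"
  shows "tour R x y {y}"
proof -
  obtain n where "(x, y) \<in> R ^^ n"
    using assms rtrancl_imp_relpow by blast
  then obtain p where "p 0 = x" "p n = y" "\<forall>i<n. (p i, p (Suc i)) \<in> R"
    unfolding relpow_fun_conv by blast
  then show ?thesis unfolding tour_def by blast
qed

text \<open>
  Symmetry allows a round trip from \<open>x\<close> to each point of \<open>Y\<close> in turn; the way to \<open>z\<close> comes last.
\<close>
lemma tour_through_finite_set:
  assumes "sym R" "finite Y" "\<And>y. y \<in> Y \<Longrightarrow> (x, y) \<in> R\<^sup>*" "(x, z) \<in> R\<^sup>*"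
  shows "tour R x z Y"
proof -
  have "tour R x x Y"
    using assms(2,3)
  proof (induction Y)
    case empty
    then show ?case unfolding tour_def by (intro exI[of _ 0] exI[of _ "\<lambda>_. x"]) auto
  next
    case (insert y Y)
    have "(y, x) \<in> R\<^sup>*"
      using insert.prems assms(1) by (meson insertI1 symE sym_rtrancl)
    with insert.prems have "tour R x x ({y} \<union> {x})"
      by (intro tour_append[of R x y] rtrancl_imp_tour) auto
    moreover have "tour R x x Y" using insert by blast
    ultimately have "tour R x x (Y \<union> ({y} \<union> {x}))" by (rule tour_append[rotated])
    then show ?case unfolding tour_def by (elim ex_forward) blast
  qed
  from tour_append[OF this rtrancl_imp_tour[OF assms(4)]] show ?thesis
    unfolding tour_def by (elim ex_forward) blast
qed

section \<open>Small connected sets and fine chains\<close>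

context Metric_space
begin

text \<open>
  Otherwise the neighbourhoods of radius \<open>\<eta>\<close> around the points that chains from \<open>x\<close> reach and
  around those that they miss would separate \<open>C\<close>.
\<close>
lemma connectedin_imp_chain:
  assumes C: "connectedin mtopology C" and x: "x \<in> C" and y: "y \<in> C" and "0 < \<eta>"
  shows "(x, y) \<in> {(a, b). a \<in> C \<and> b \<in> C \<and> d a b < \<eta>}\<^sup>*" (is "_ \<in> ?R\<^sup>*")
proof (rule ccontr)
  assume n: "(x, y) \<notin> ?R\<^sup>*"
  have CM: "C \<subseteq> M" using C connectedin_subset_topspace by fastforce
  define E where "E P = (\<Union>z \<in> {z \<in> C. ((x, z) \<in> ?R\<^sup>*) = P}. mball z \<eta>)" for P
  have "openin mtopology (E P)" for P unfolding E_def by blast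
  moreover have "C \<subseteq> E True \<union> E False"
    unfolding E_def using CM \<open>0 < \<eta>\<close> by auto
  moreover have "E True \<inter> E False \<inter> C = {}"
  proof -
    have sep: False if "u \<in> C" "(x, u) \<in> ?R\<^sup>*" "v \<in> C" "(x, v) \<notin> ?R\<^sup>*" "w \<in> C" "d u w < \<eta>" "d v w < \<eta>"
      for u v w
    proof -
      have "(u, w) \<in> ?R" "(w, v) \<in> ?R" using that commute by auto
      then have "(x, v) \<in> ?R\<^sup>*" using that(2) by (meson rtrancl.rtrancl_into_rtrancl)
      with that show False by blast
    qed
    have near: "\<exists>u. u \<in> C \<and> ((x, u) \<in> ?R\<^sup>*) = P \<and> d u w < \<eta>" if "w \<in> E P" for w P
      using that unfolding E_def by auto
    have "w \<notin> E False" if w: "w \<in> E True" "w \<in> C" for w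
    proof
      assume "w \<in> E False"
      then obtain v where "v \<in> C" "(x, v) \<notin> ?R\<^sup>*" "d v w < \<eta>" using near by blast
      moreover obtain u where "u \<in> C" "(x, u) \<in> ?R\<^sup>*" "d u w < \<eta>" using near[OF w(1)] by blast
      ultimately show False using w(2) sep by blast
    qed
    then show ?thesis by blast
  qed
  moreover have "E True \<inter> C \<noteq> {}"
  proof -
    have "x \<in> E True" unfolding E_def using x CM \<open>0 < \<eta>\<close> by (intro UN_I[of x]) auto
    then show ?thesis using x by blast
  qed
  moreover have "E False \<inter> C \<noteq> {}"
  proof -
    have "y \<in> E False" unfolding E_def using n y CM \<open>0 < \<eta>\<close> by (intro UN_I[of y]) auto
    then show ?thesis using y by blast
  qed
  ultimately show False using C unfolding connectedin by blast
qed

text \<open>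
  The modulus of uniform local connectedness: \<open>\<delta>\<close>-close points lie in a common connected set of
  size \<open>\<epsilon>\<close>.  By the previous lemma such points are joined inside the \<open>\<epsilon>\<close>-ball by chains of any
  fineness, while \<open>\<delta>\<close> stays the same.
\<close>
definition joined_within :: "real \<Rightarrow> real \<Rightarrow> bool" where
  "joined_within \<delta> \<epsilon> \<longleftrightarrow>
     (\<forall>x \<in> M. \<forall>y \<in> mball x \<delta>.
        \<exists>C. connectedin mtopology C \<and> x \<in> C \<and> y \<in> C \<and> C \<subseteq> mball x \<epsilon>)"

lemma joined_withinD:
  assumes "joined_within \<delta> \<epsilon>" "x \<in> M" "y \<in> mball x \<delta>"
  shows "\<exists>C. connectedin mtopology C \<and> x \<in> C \<and> y \<in> C \<and> C \<subseteq> mball x \<epsilon>"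
  using assms by (simp only: joined_within_def)

text \<open>
  A Lebesgue number of a cover by connected open sets of radius \<open>\<epsilon>/2\<close> serves as \<open>\<delta>\<close>.
\<close>
lemma uniformly_locally_connected:
  assumes "compact_space mtopology" "locally_connected_space mtopology" "0 < \<epsilon>"
  obtains \<delta> where "0 < \<delta>" "joined_within \<delta> \<epsilon>"
proof -
  let ?\<C> = "{V. openin mtopology V \<and> connectedin mtopology V \<and> (\<exists>z\<in>M. V \<subseteq> mball z (\<epsilon>/2))}"
  have "\<exists>V\<in>?\<C>. z \<in> V" if "z \<in> M" for z
  proof -
    have "openin mtopology (mball z (\<epsilon>/2))" "z \<in> mball z (\<epsilon>/2)" using that assms(3) by auto
    then obtain V where "openin mtopology V" "connectedin mtopology V" "z \<in> V" "V \<subseteq> mball z (\<epsilon>/2)"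
      using assms(2) unfolding locally_connected_space by meson
    then show ?thesis using that by blast
  qed
  then have "M \<subseteq> \<Union>?\<C>" by blast
  then obtain \<delta> where \<delta>: "\<delta> > 0" "\<And>x. x \<in> M \<Longrightarrow> \<exists>U\<in>?\<C>. mball x \<delta> \<subseteq> U"
    using lebesgue_number[of M ?\<C>] assms(1)
    unfolding compact_space_def topspace_mtopology by (metis (no_types, lifting) mem_Collect_eq)
  have "joined_within \<delta> \<epsilon>"
    unfolding joined_within_def
  proof (intro ballI)
    fix x y assume x: "x \<in> M" and y: "y \<in> mball x \<delta>"
    obtain U z where U: "connectedin mtopology U" "z \<in> M" "U \<subseteq> mball z (\<epsilon>/2)" "mball x \<delta> \<subseteq> U"
      using \<delta>(2)[OF x] by blast
    have xU: "x \<in> U" using U(4) x \<delta>(1) by auto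
    have "U \<subseteq> mball x \<epsilon>"
    proof
      fix u assume "u \<in> U"
      then have "u \<in> M" "d z u < \<epsilon>/2" "d z x < \<epsilon>/2" using U(3) xU by auto
      then have "d x u < \<epsilon>"
        using triangle''[of x z u] x U(2) commute by fastforce
      then show "u \<in> mball x \<epsilon>" using x \<open>u \<in> M\<close> by auto
    qed
    then show "\<exists>C. connectedin mtopology C \<and> x \<in> C \<and> y \<in> C \<and> C \<subseteq> mball x \<epsilon>"
      using U xU y by blast
  qed
  then show ?thesis using \<delta>(1) that by blast
qed

text \<open>
  The step that one edge of a walk is replaced with in the next, finer walk: it tours an \<open>\<eta>\<close>-net of
  the \<open>\<delta>\<close>-ball without leaving the \<open>\<epsilon>\<close>-ball.  The path is an infinite sequence that is constant from
  \<open>m\<close> on, so it can be stopped at any later time.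
\<close>
lemma dense_local_tour:
  assumes "compact_space mtopology" "joined_within \<delta> \<epsilon>" "x \<in> M" "x' \<in> mball x \<delta>" "0 < \<eta>"
  obtains p m where "p 0 = x" "\<And>j. m \<le> j \<Longrightarrow> p j = x'" "\<And>j. p j \<in> mball x \<epsilon>"
    "\<And>j. d (p j) (p (Suc j)) < \<eta>"
    "\<And>y. y \<in> mball x \<delta> \<Longrightarrow> \<exists>j\<le>m. d y (p j) < \<eta>"
proof -
  define R where "R = {(a, b). a \<in> mball x \<epsilon> \<and> b \<in> mball x \<epsilon> \<and> d a b < \<eta>}"
  have reach: "(x, y) \<in> R\<^sup>*" if y: "y \<in> mball x \<delta>" for y
  proof -
    obtain C where C: "connectedin mtopology C" "x \<in> C" "y \<in> C" "C \<subseteq> mball x \<epsilon>"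
      using joined_withinD[OF assms(2,3) y] by blast
    have "{(a, b). a \<in> C \<and> b \<in> C \<and> d a b < \<eta>} \<subseteq> R"
      unfolding R_def using C(4) by blast
    then show ?thesis
      using connectedin_imp_chain[OF C(1-3) assms(5)] rtrancl_mono by blast
  qed
  have x\<epsilon>: "x' \<in> mball x \<epsilon>" "x \<in> mball x \<epsilon>"
    using joined_withinD[OF assms(2-4)] by blast+
  have "mtotally_bounded (mball x \<delta>)"
    using assms(1) compactin_imp_mtotally_bounded[of M] mtotally_bounded_subset
    by (metis compact_space_def mball_subset_mspace topspace_mtopology)
  then obtain Y where Y: "finite Y" "Y \<subseteq> mball x \<delta>" "mball x \<delta> \<subseteq> (\<Union>y\<in>Y. mball y \<eta>)"
    using assms(5) unfolding mtotally_bounded_def by meson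
  have "sym R" unfolding R_def sym_def using commute by auto
  then have "tour R x x' Y"
    using Y(1,2) reach assms(4) by (intro tour_through_finite_set) auto
  then obtain m q where q: "q 0 = x" "q m = x'" "\<forall>i<m. (q i, q (Suc i)) \<in> R" "Y \<subseteq> q ` {..m}"
    unfolding tour_def by blast
  define p where "p j = q (min j m)" for j
  show ?thesis
  proof (rule that)
    show "p j = x'" if "m \<le> j" for j
      using q(2) that by (auto simp: p_def min_def)
    show "p j \<in> mball x \<epsilon>" for j
    proof (cases "j < m")
      case True
      then show ?thesis using q(3) by (auto simp: p_def min_def R_def)
    next
      case False
      then show ?thesis using q(2) x\<epsilon> by (auto simp: p_def min_def)
    qed
    show "d (p j) (p (Suc j)) < \<eta>" for j
    proof (cases "j < m")
      case True
      then show ?thesis using q(3) by (auto simp: p_def min_def R_def)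
    next
      case False
      then show ?thesis using q(2) x\<epsilon> assms(5) by (auto simp: p_def min_def)
    qed
    show "\<exists>j\<le>m. d y (p j) < \<eta>" if y: "y \<in> mball x \<delta>" for y
    proof -
      obtain z where "z \<in> Y" "d z y < \<eta>" using Y(3) y by auto
      moreover from this obtain j where "j \<le> m" "z = q j" using q(4) by auto
      ultimately show ?thesis using commute by (intro exI[of _ j]) (auto simp: p_def min_def)
    qed
  qed (use q in \<open>auto simp: p_def\<close>)
qed

section \<open>Walks and their refinements\<close>
definition walk :: "real \<Rightarrow> nat \<Rightarrow> (nat \<Rightarrow> 'a) \<Rightarrow> bool" where
  "walk \<delta> N w \<longleftrightarrow> (\<forall>i\<le>N. w i \<in> M) \<and> (\<forall>i<N. d (w i) (w (Suc i)) < \<delta>)"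

text \<open>
  Every edge of \<open>w\<close> becomes a block of \<open>L\<close> edges of \<open>w'\<close>.  The block stays \<open>\<epsilon>\<close>-close to the
  starting point of the edge, which makes successive refinements converge uniformly, and it is
  \<open>\<eta>\<close>-dense in the \<open>\<delta>\<close>-ball there, which makes the limit cover that ball.
\<close>
definition refines_walk ::
  "real \<Rightarrow> real \<Rightarrow> real \<Rightarrow> nat \<Rightarrow> (nat \<Rightarrow> 'a) \<Rightarrow> nat \<Rightarrow> (nat \<Rightarrow> 'a) \<Rightarrow> bool" where
  "refines_walk \<delta> \<epsilon> \<eta> N w L w' \<longleftrightarrow>
     (\<forall>i\<le>N. w' (i * L) = w i) \<and>
     (\<forall>i<N. \<forall>j<L. w' (i * L + j) \<in> mball (w i) \<epsilon>) \<and>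
     (\<forall>i<N. \<forall>y \<in> mball (w i) \<delta>. \<exists>j<L. d y (w' (i * L + j)) < \<eta>)"

text \<open>
  All blocks must have the same length, and the finitely many local tours become equally long by
  waiting at their end points.  Waiting longer makes \<open>L\<close> exceed any given \<open>K\<close>.
\<close>
lemma exists_refining_walk:
  assumes "compact_space mtopology" "joined_within \<delta> \<epsilon>" "0 < \<eta>" and w: "walk \<delta> N w"
  shows "\<exists>L w'. K < L \<and> walk \<eta> (N * L) w' \<and> refines_walk \<delta> \<epsilon> \<eta> N w L w'"
proof -
  have "\<exists>p m. i < N \<longrightarrow> p 0 = w i \<and> (\<forall>j\<ge>m. p j = w (Suc i)) \<and> (\<forall>j. p j \<in> mball (w i) \<epsilon>) \<and>
      (\<forall>j. d (p j) (p (Suc j)) < \<eta>) \<and> (\<forall>y \<in> mball (w i) \<delta>. \<exists>j\<le>m. d y (p j) < \<eta>)" for i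
  proof (cases "i < N")
    case True
    then have "w i \<in> M" "w (Suc i) \<in> mball (w i) \<delta>" using w unfolding walk_def by auto
    from dense_local_tour[OF assms(1,2) this assms(3)] show ?thesis by metis
  qed simp
  then obtain p m where p: "\<And>i. i < N \<Longrightarrow> p i 0 = w i \<and> (\<forall>j\<ge>m i. p i j = w (Suc i)) \<and>
      (\<forall>j. p i j \<in> mball (w i) \<epsilon>) \<and> (\<forall>j. d (p i j) (p i (Suc j)) < \<eta>) \<and>
      (\<forall>y \<in> mball (w i) \<delta>. \<exists>j\<le>m i. d y (p i j) < \<eta>)"
    by metis
  \<comment> \<open>The successor makes each tour end strictly inside its block, so that the end point of the tour
    still begins a cell of that block.\<close>
  define L where "L = Suc (K + (\<Sum>i<N. m i))"
  have mL: "m i < L" if "i < N" for i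
    using member_le_sum[of i "{..<N}" m] that unfolding L_def by auto
  have "K < L" "0 < L" by (auto simp: L_def)
  define w' where "w' k = (if k < N * L then p (k div L) (k mod L) else w N)" for k
  have block: "i * L + j < N * L" if "i < N" "j < L" for i j
  proof -
    have "i * L + j < Suc i * L" using that by simp
    also have "\<dots> \<le> N * L" using that by (intro mult_le_mono1) simp
    finally show ?thesis .
  qed
  have w'p: "w' (i * L + j) = p i j" if "i < N" "j < L" for i j
    using block[OF that] that by (simp add: w'_def)
  have w'L: "w' (i * L) = w i" if "i \<le> N" for i
  proof (cases "i < N")
    case True
    then show ?thesis using w'p[of i 0] p[of i] \<open>0 < L\<close> by simp
  next
    case False
    then show ?thesis using that by (simp add: w'_def)
  qed
  have w'p_le: "w' (i * L + j) = p i j" if "i < N" "j \<le> L" for i j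
  proof (cases "j < L")
    case False
    then have "j = L" using that by simp
    then have "w' (i * L + j) = w (Suc i)" using w'L[of "Suc i"] that by (simp add: add.commute)
    then show ?thesis using p[of i] mL[of i] that \<open>j = L\<close> by simp
  qed (use w'p that in blast)
  have "walk \<eta> (N * L) w'"
    unfolding walk_def
  proof (intro conjI allI impI)
    fix k assume k: "k < N * L"
    have "k div L < N" "k mod L < L" using k \<open>0 < L\<close> by (auto simp: less_mult_imp_div_less)
    then have "w' k = p (k div L) (k mod L)" "w' (Suc k) = p (k div L) (Suc (k mod L))"
      using w'p_le[of "k div L" "k mod L"] w'p_le[of "k div L" "Suc (k mod L)"] by simp_all
    then show "d (w' k) (w' (Suc k)) < \<eta>" using p \<open>k div L < N\<close> by simp
  next
    fix k assume k: "k \<le> N * L"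
    show "w' k \<in> M"
    proof (cases "k < N * L")
      case True
      then have "k div L < N" using \<open>0 < L\<close> by (auto simp: less_mult_imp_div_less)
      then show ?thesis using p[of "k div L"] True by (simp add: w'_def)
    next
      case False
      then show ?thesis using w by (simp add: w'_def walk_def)
    qed
  qed
  moreover have "refines_walk \<delta> \<epsilon> \<eta> N w L w'"
    unfolding refines_walk_def
  proof (intro conjI allI impI ballI)
    fix i y assume i: "i < N" and y: "y \<in> mball (w i) \<delta>"
    obtain j where "j \<le> m i" "d y (p i j) < \<eta>" using p[OF i] y by blast
    then show "\<exists>j<L. d y (w' (i * L + j)) < \<eta>"
      using mL[OF i] w'p[OF i, of j] by (intro exI[of _ j]) auto
  qed (use w'L w'p p in auto)
  ultimately show ?thesis using \<open>K < L\<close> by blast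
qed

lemma exists_refining_walks:
  assumes "compact_space mtopology" "M \<noteq> {}"
    and \<delta>: "\<And>n. 0 < \<delta> n" "\<And>n. joined_within (\<delta> n) (\<epsilon> n)"
  shows "\<exists>N L w. \<forall>n. K n < N n \<and> walk (\<delta> n) (N n) (w n) \<and> N (Suc n) = N n * L n \<and> 0 < L n \<and>
    refines_walk (\<delta> n) (\<epsilon> n) (\<delta> (Suc n)) (N n) (w n) (L n) (w (Suc n))"
proof -
  let ?P = "\<lambda>n (N, w). K n < N \<and> walk (\<delta> n) N w"
  let ?Q = "\<lambda>n (N, w) (N', w'). \<exists>L>0. N' = N * L \<and> refines_walk (\<delta> n) (\<epsilon> n) (\<delta> (Suc n)) N w L w'"
  obtain x0 where "x0 \<in> M" using assms(2) by blast
  have "\<exists>s. \<forall>n. ?P n (s n) \<and> ?Q n (s n) (s (Suc n))"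
  proof (rule dependent_nat_choice)
    show "\<exists>s. ?P 0 s"
      using \<open>x0 \<in> M\<close> \<delta>(1) by (intro exI[of _ "(Suc (K 0), \<lambda>_. x0)"]) (auto simp: walk_def)
  next
    fix s n assume "?P n s"
    moreover obtain N w where s: "s = (N, w)" by fastforce
    ultimately have N: "K n < N" "walk (\<delta> n) N w" by auto
    obtain L w' where L: "K (Suc n) < L" "walk (\<delta> (Suc n)) (N * L) w'"
      "refines_walk (\<delta> n) (\<epsilon> n) (\<delta> (Suc n)) N w L w'"
      using exists_refining_walk[OF assms(1) \<delta>(2) \<delta>(1) N(2)] by blast
    have "1 * L \<le> N * L" using N(1) by (intro mult_le_mono1) simp
    then have "K (Suc n) < N * L" using L(1) by linarith
    then show "\<exists>s'. ?P (Suc n) s' \<and> ?Q n s s'"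
      using L s by (intro exI[of _ "(N * L, w')"]) (auto intro!: exI[of _ L])
  qed
  then obtain s where s: "\<And>n. ?P n (s n) \<and> ?Q n (s n) (s (Suc n))" by blast
  have "\<forall>n. \<exists>L>0. fst (s (Suc n)) = fst (s n) * L \<and>
      refines_walk (\<delta> n) (\<epsilon> n) (\<delta> (Suc n)) (fst (s n)) (snd (s n)) L (snd (s (Suc n)))"
    using s by (auto simp: case_prod_beta)
  then obtain L where "\<forall>n. L n>0 \<and> fst (s (Suc n)) = fst (s n) * L n \<and>
      refines_walk (\<delta> n) (\<epsilon> n) (\<delta> (Suc n)) (fst (s n)) (snd (s n)) (L n) (snd (s (Suc n)))"
    by metis
  then show ?thesis
    using s
    by (intro exI[of _ "fst \<circ> s"] exI[of _ L] exI[of _ "snd \<circ> s"]) (auto simp: case_prod_beta)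
qed

end

section \<open>A parametrization that is open on cells\<close>

definition cell :: "nat \<Rightarrow> nat \<Rightarrow> real set" where
  "cell N i = {real i / real N .. (real i + 1) / real N}"

lemma cell_subset_unit: "i < N \<Longrightarrow> cell N i \<subseteq> {0..1}"
  unfolding cell_def by (auto simp: field_simps)

lemma cell_mult_subset:
  assumes "0 < N" "j < L"
  shows "cell (N * L) (i * L + j) \<subseteq> cell N i"
proof -
  have L: "real j + 1 \<le> real L" "0 < L" using assms by auto
  have e: "real i / real N = (real i * real L) / (real N * real L)"
    "(real i + 1) / real N = (real i * real L + real L) / (real N * real L)"
    using L(2) mult_divide_mult_cancel_right[of "real L" "real i + 1" "real N"]
    by (simp_all add: distrib_right)
  then show ?thesis
    unfolding cell_def atLeastatMost_subset_iff e of_nat_add of_nat_mult using L(1)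
    by (intro disjI2 conjI divide_right_mono) simp_all
qed

context Metric_space
begin

text \<open>
  Reading the \<open>n\<close>-th walk as a step function with \<open>N n\<close> steps gives a uniformly Cauchy sequence.  Its
  limit is continuous since the jumps of the step functions tend to zero.  It covers the balls since
  a point near the vertex of a cell has, inside that cell, vertices of the later walks at distances
  tending to zero, so that the image of the cell, which is compact, has it in its closure.
\<close>
lemma limit_of_refining_walks:
  assumes "mcomplete" "0 < D"
    and \<delta>: "\<And>n. \<delta> n \<le> D / 2 ^ n"
    and N: "\<And>n. 0 < N n" "\<And>n. N (Suc n) = N n * L n" "\<And>n. 0 < L n"
    and w: "\<And>n. walk (\<delta> n) (N n) (w n)"
    and ref: "\<And>n. refines_walk (\<delta> n) (D / 2 ^ n) (\<delta> (Suc n)) (N n) (w n) (L n) (w (Suc n))"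
  shows "\<exists>g. continuous_map (top_of_set {0..1}) mtopology g \<and>
    (\<forall>n. \<forall>i<N n. mball (w n i) (\<delta> n) \<subseteq> g ` cell (N n) i)"
proof -
  define k where "k n t = nat \<lfloor>t * real (N n)\<rfloor>" for n t
  define G where "G n t = w n (k n t)" for n t
  have wM: "w n i \<in> M" if "i \<le> N n" for n i
    using w[of n] that by (simp add: walk_def)
  have k_le: "k n t \<le> N n" if "t \<in> {0..1}" for n t
  proof -
    have "t * real (N n) \<le> real (N n)" using that by (simp add: mult_left_le_one_le)
    then show ?thesis unfolding k_def by linarith
  qed
  have GM: "G n t \<in> M" if "t \<in> {0..1}" for n t
    using k_le[OF that] wM by (simp add: G_def)
  have k_Suc: "k n t = k (Suc n) t div L n" if "t \<in> {0..1}" for n t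
  proof -
    have "t * real (N n) = t * real (N (Suc n)) / real_of_int (int (L n))"
      using N(3)[of n] by (simp add: N(2))
    then have "\<lfloor>t * real (N n)\<rfloor> = \<lfloor>t * real (N (Suc n))\<rfloor> div int (L n)"
      using floor_divide_real_eq_div[of "int (L n)" "t * real (N (Suc n))"] by simp
    then show ?thesis
      unfolding k_def using that by (simp add: nat_div_distrib)
  qed
  \<comment> \<open>At \<open>t = 1\<close> the index is the last vertex, which belongs to no block; this case is separate.\<close>
  have step: "d (G n t) (G (Suc n) t) \<le> D / 2 ^ n" if t: "t \<in> {0..1}" for n t
  proof (cases "k n t < N n")
    case True
    have "k (Suc n) t = k n t * L n + k (Suc n) t mod L n"
      using k_Suc[OF t, of n] by simp
    moreover have "k (Suc n) t mod L n < L n" using N(3) by simp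
    ultimately have "w (Suc n) (k (Suc n) t) \<in> mball (w n (k n t)) (D / 2 ^ n)"
      using ref[of n] True unfolding refines_walk_def by metis
    then show ?thesis by (auto simp: G_def)
  next
    case False
    then have kN: "k n t = N n" using k_le[OF t, of n] by simp
    then have "N n * L n \<le> k (Suc n) t"
      using k_Suc[OF t, of n] by (metis div_times_less_eq_dividend)
    then have "k (Suc n) t = N n * L n" using k_le[OF t, of "Suc n"] N(2) by simp
    then have "G (Suc n) t = G n t"
      using ref[of n] kN by (simp add: G_def refines_walk_def)
    then show ?thesis using GM[OF t] \<open>0 < D\<close> by simp
  qed
  have tail: "d (G n t) (G m t) \<le> 2 * D / 2 ^ n - 2 * D / 2 ^ m" if t: "t \<in> {0..1}" and "n \<le> m" for n m t
    using \<open>n \<le> m\<close>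
  proof (induction m rule: dec_induct)
    case base
    then show ?case using GM[OF t] by simp
  next
    case (step m)
    have "d (G n t) (G (Suc m) t) \<le> d (G n t) (G m t) + d (G m t) (G (Suc m) t)"
      using GM[OF t] triangle by simp
    also have "\<dots> \<le> (2 * D / 2 ^ n - 2 * D / 2 ^ m) + D / 2 ^ m"
      using step.IH \<open>\<And>t n. t \<in> {0..1} \<Longrightarrow> d (G n t) (G (Suc n) t) \<le> D / 2 ^ n\<close>[OF t] by (rule add_mono)
    also have "\<dots> = 2 * D / 2 ^ n - 2 * D / 2 ^ Suc m" by (simp add: field_simps)
    finally show ?case .
  qed
  have small: "\<exists>n. C * D / 2 ^ n < e" if "0 < e" for e C :: real
  proof -
    have "(\<lambda>n. C * D * (1 / 2) ^ n) \<longlonglongrightarrow> C * D * 0"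
      by (intro tendsto_mult tendsto_const LIMSEQ_power_zero) simp
    then have "\<forall>\<^sub>F n in sequentially. C * D * (1 / 2) ^ n < e"
      using that by (intro order_tendstoD) auto
    then show ?thesis by (auto simp: eventually_sequentially power_one_over)
  qed
  have tail2: "d (G n t) (G m t) \<le> 2 * D / 2 ^ n" if "t \<in> {0..1}" "n \<le> m" for n m t
    using tail[OF that] \<open>0 < D\<close> by (smt (verit) divide_nonneg_pos zero_less_power)
  have "\<exists>x. limitin mtopology (\<lambda>n. G n t) x sequentially" if t: "t \<in> {0..1}" for t
  proof -
    have "MCauchy (\<lambda>n. G n t)"
      unfolding MCauchy_def
    proof (intro conjI allI impI)
      show "range (\<lambda>n. G n t) \<subseteq> M" using GM[OF t] by auto
      fix e :: real assume "0 < e"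
      then obtain n where n: "4 * D / 2 ^ n < e" using small by blast
      have "d (G m t) (G m' t) < e" if "n \<le> m" "n \<le> m'" for m m'
        using triangle''[of "G m t" "G n t" "G m' t"] GM[OF t] tail2[OF t that(1)] tail2[OF t that(2)] n
        by simp
      then show "\<exists>n. \<forall>m m'. n \<le> m \<longrightarrow> n \<le> m' \<longrightarrow> d (G m t) (G m' t) < e" by blast
    qed
    then show ?thesis using \<open>mcomplete\<close> by (simp add: mcomplete_def)
  qed
  then obtain g where g: "\<And>t. t \<in> {0..1} \<Longrightarrow> limitin mtopology (\<lambda>n. G n t) (g t) sequentially"
    by metis
  have gM: "g t \<in> M" if "t \<in> {0..1}" for t
    using g[OF that] limitin_mspace by blast
  have Gg: "d (G n t) (g t) \<le> 2 * D / 2 ^ n" if t: "t \<in> {0..1}" for n t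
  proof (rule field_le_epsilon)
    fix e :: real assume "0 < e"
    then have "\<forall>\<^sub>F m in sequentially. d (G m t) (g t) < e"
      using g[OF t] by (auto simp: limitin_metric elim: eventually_mono)
    then obtain m where m: "n \<le> m" "d (G m t) (g t) < e"
      by (metis (no_types, lifting) eventually_sequentially nat_le_linear)
    show "d (G n t) (g t) \<le> 2 * D / 2 ^ n + e"
      using triangle[of "G n t" "G m t" "g t"] GM[OF t] gM[OF t] tail2[OF t m(1)] m(2) by simp
  qed
  have osc: "d (g s) (g t) \<le> 5 * D / 2 ^ n"
    if st: "s \<in> {0..1}" "t \<in> {0..1}" "\<bar>s - t\<bar> * real (N n) < 1" for s t n
  proof -
    have near: "d (G n s) (G n t) \<le> D / 2 ^ n"
      if st: "s \<in> {0..1}" "t \<in> {0..1}" "(t - s) * real (N n) < 1" "s \<le> t" for s t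
    proof -
      have "s * real (N n) \<le> t * real (N n)" using st by (simp add: mult_right_mono)
      moreover have "t * real (N n) < s * real (N n) + 1" using st(3) by (simp add: algebra_simps)
      moreover have "0 \<le> s * real (N n)" using st by simp
      ultimately have "k n t = k n s \<or> k n t = Suc (k n s)" unfolding k_def by linarith
      then show ?thesis
      proof
        assume "k n t = k n s"
        then show ?thesis using GM[OF st(1), of n] \<open>0 < D\<close> by (simp add: G_def)
      next
        assume ks: "k n t = Suc (k n s)"
        then have "k n s < N n" using k_le[OF st(2), of n] by simp
        then have "d (G n s) (G n t) < \<delta> n" using w[of n] ks by (simp add: G_def walk_def)
        then show ?thesis using \<delta>[of n] by simp
      qed
    qed
    have "d (G n s) (G n t) \<le> D / 2 ^ n"
      using near[of s t] near[of t s] st commute by (cases "s \<le> t") auto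
    moreover have "d (g s) (g t) \<le> d (g s) (G n s) + d (G n s) (g t)"
      using triangle gM GM st by blast
    moreover have "d (G n s) (g t) \<le> d (G n s) (G n t) + d (G n t) (g t)"
      using triangle gM GM st by blast
    ultimately show ?thesis using Gg[OF st(1), of n] Gg[OF st(2), of n] commute[of "g s"] by simp
  qed
  have cont: "continuous_map (top_of_set {0..1}) mtopology g"
    unfolding continuous_map_to_metric
  proof (intro ballI allI impI)
    fix t and e :: real assume "t \<in> topspace (top_of_set {0..1::real})" "0 < e"
    then have t: "t \<in> {0..1}" by simp
    obtain n where n: "5 * D / 2 ^ n < e" using small \<open>0 < e\<close> by blast
    \<comment> \<open>Within distance \<open>1 / N n\<close> the indices in the \<open>n\<close>-th walk differ by at most one.\<close>
    let ?U = "{0..1} \<inter> ball t (1 / real (N n))"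
    have "\<forall>s\<in>?U. g s \<in> mball (g t) e"
    proof
      fix s assume s: "s \<in> ?U"
      then have "\<bar>t - s\<bar> * real (N n) < 1" using N(1)[of n] by (simp add: dist_real_def field_simps)
      then have "d (g t) (g s) \<le> 5 * D / 2 ^ n" using osc t s by blast
      then show "g s \<in> mball (g t) e" using n gM t s by auto
    qed
    moreover have "t \<in> ?U" using t N(1)[of n] by simp
    moreover have "openin (top_of_set {0..1}) ?U" by (simp add: openin_open_Int)
    ultimately show "\<exists>U. openin (top_of_set {0..1}) U \<and> t \<in> U \<and> (\<forall>s\<in>U. g s \<in> mball (g t) e)"
      by blast
  qed
  moreover have "mball (w n i) (\<delta> n) \<subseteq> g ` cell (N n) i" if i: "i < N n" for n i
  proof
    fix y assume y: "y \<in> mball (w n i) (\<delta> n)"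
    have near: "\<exists>i' < N m. cell (N m) i' \<subseteq> cell (N n) i \<and> y \<in> mball (w m i') (\<delta> m)" if "n \<le> m" for m
      using that
    proof (induction m rule: dec_induct)
      case base
      then show ?case using i y by blast
    next
      case (step m)
      then obtain i' where i': "i' < N m" "cell (N m) i' \<subseteq> cell (N n) i" "y \<in> mball (w m i') (\<delta> m)"
        by blast
      then obtain j where j: "j < L m" "d y (w (Suc m) (i' * L m + j)) < \<delta> (Suc m)"
        using ref[of m] unfolding refines_walk_def by blast
      have "i' * L m + j < Suc i' * L m" using j(1) by simp
      also have "\<dots> \<le> N m * L m" using i'(1) by (intro mult_le_mono1) simp
      finally have lt: "i' * L m + j < N (Suc m)" using N(2) by simp
      have "cell (N (Suc m)) (i' * L m + j) \<subseteq> cell (N n) i"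
        using cell_mult_subset[OF N(1)[of m] j(1), of i'] i'(2) N(2) by simp
      moreover have "y \<in> mball (w (Suc m) (i' * L m + j)) (\<delta> (Suc m))"
        using j(2) lt wM[of _ "Suc m"] y commute by auto
      ultimately show ?case using lt by blast
    qed
    have "\<exists>t \<in> cell (N n) i. d (g t) y < e" if "0 < e" for e
    proof -
      obtain m0 where m0: "3 * D / 2 ^ m0 < e" using small \<open>0 < e\<close> by blast
      define m where "m = max m0 n"
      have m: "n \<le> m" "3 * D / 2 ^ m < e"
      proof -
        have "3 * D / 2 ^ m \<le> 3 * D / 2 ^ m0"
          using \<open>0 < D\<close> by (intro divide_left_mono power_increasing) (auto simp: m_def)
        then show "3 * D / 2 ^ m < e" using m0 by simp
      qed (simp add: m_def)
      obtain i' where i': "i' < N m" "cell (N m) i' \<subseteq> cell (N n) i" "y \<in> mball (w m i') (\<delta> m)"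
        using near[OF m(1)] by blast
      define t where "t = real i' / real (N m)"
      have "t \<in> cell (N m) i'" by (simp add: t_def cell_def divide_right_mono)
      then have t: "t \<in> cell (N n) i" "t \<in> {0..1}"
        using i'(2) cell_subset_unit[OF i] by blast+
      have "k m t = i'" using N(1)[of m] by (simp add: k_def t_def)
      then have "d (w m i') (g t) \<le> 2 * D / 2 ^ m" using Gg[OF t(2), of m] by (simp add: G_def)
      moreover have "d (w m i') y < D / 2 ^ m" using i'(3) \<delta>[of m] by auto
      moreover have "d (g t) y \<le> d (w m i') (g t) + d (w m i') y"
        using i'(3) gM[OF t(2)] triangle''[of "g t" "w m i'" y] by auto
      ultimately have "d (g t) y < e" using m(2) by simp
      then show ?thesis using t(1) by blast
    qed
    then have "\<exists>z \<in> g ` cell (N n) i. z \<in> mball y e" if "0 < e" for e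
      using that y gM cell_subset_unit[OF i] commute by (metis image_eqI in_mball subsetD)
    then have "y \<in> mtopology closure_of (g ` cell (N n) i)"
      using y unfolding metric_closure_of by simp
    moreover have "compactin mtopology (g ` cell (N n) i)"
      using cell_subset_unit[OF i]
      by (intro image_compactin[OF _ cont]) (auto simp: compactin_subtopology cell_def)
    then have "closedin mtopology (g ` cell (N n) i)"
      using compactin_imp_closedin Hausdorff_space_mtopology by blast
    ultimately show "y \<in> g ` cell (N n) i" by (simp add: closure_of_closedin)
  qed
  ultimately show ?thesis by blast
qed

text \<open>
  The order of quantifiers is essential: \<open>\<delta>\<close> is fixed before \<open>K\<close>, so the cells can be made small
  compared with the images that they are guaranteed to have.  The first radius \<open>\<delta> 0\<close> exceeds the
  diameter, which makes every cell of level \<open>0\<close> cover the whole space.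
\<close>
theorem cellwise_open_parametrization:
  assumes "compact_space mtopology" "connected_space mtopology" "locally_connected_space mtopology"
    and "M \<noteq> {}"
  obtains \<delta> :: "nat \<Rightarrow> real" where "\<And>n. 0 < \<delta> n" "\<And>x. x \<in> M \<Longrightarrow> mball x (\<delta> 0) = M"
    "\<And>K. \<exists>g N. continuous_map (top_of_set {0..1}) mtopology g \<and> (\<forall>n. K n < N n) \<and>
       (\<forall>n. \<forall>i<N n. \<exists>x\<in>M. mball x (\<delta> n) \<subseteq> g ` cell (N n) i)"
proof -
  have "mbounded M" using assms(1) compactin_imp_mbounded by (simp add: compact_space_def)
  then obtain B where B: "\<And>x y. x \<in> M \<Longrightarrow> y \<in> M \<Longrightarrow> d x y \<le> B" unfolding mbounded_alt by blast
  define D where "D = \<bar>B\<bar> + 1"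
  have D: "0 < D" "\<And>x y. x \<in> M \<Longrightarrow> y \<in> M \<Longrightarrow> d x y < D"
    using B by (fastforce simp: D_def)+
  then have ball_D: "mball x D = M" if "x \<in> M" for x using that by auto
  have "\<exists>\<delta>>0. joined_within \<delta> (D / 2 ^ n)" for n
    using uniformly_locally_connected[OF assms(1,3), of "D / 2 ^ n"] \<open>0 < D\<close> by auto
  then obtain \<delta>' where \<delta>': "\<And>n. 0 < \<delta>' n" "\<And>n. joined_within (\<delta>' n) (D / 2 ^ n)" by metis
  define \<delta> where "\<delta> n = (if n = 0 then D else min (\<delta>' n) (D / 2 ^ n))" for n
  have pos: "0 < \<delta> n" for n using \<delta>'(1) \<open>0 < D\<close> by (simp add: \<delta>_def)
  have le: "\<delta> n \<le> D / 2 ^ n" for n by (simp add: \<delta>_def)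
  have join: "joined_within (\<delta> n) (D / 2 ^ n)" for n
  proof (cases "n = 0")
    case True
    \<comment> \<open>At level \<open>0\<close> the connected set is the whole space.\<close>
    have "connectedin mtopology M" using assms(2) connectedin_topspace[of mtopology] by simp
    then show ?thesis unfolding joined_within_def using ball_D True by (auto simp: \<delta>_def)
  next
    case False
    then have "mball x (\<delta> n) \<subseteq> mball x (\<delta>' n)" for x
      by (intro mball_subset_concentric) (simp add: \<delta>_def)
    then show ?thesis
      using joined_withinD[OF \<delta>'(2)[of n]] unfolding joined_within_def by (meson subsetD)
  qed
  have "\<exists>g N. continuous_map (top_of_set {0..1}) mtopology g \<and> (\<forall>n. K n < N n) \<and>
       (\<forall>n. \<forall>i<N n. \<exists>x\<in>M. mball x (\<delta> n) \<subseteq> g ` cell (N n) i)" for K :: "nat \<Rightarrow> nat"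
  proof -
    obtain N L w where W: "\<forall>n. K n < N n \<and> walk (\<delta> n) (N n) (w n) \<and> N (Suc n) = N n * L n \<and>
        0 < L n \<and> refines_walk (\<delta> n) (D / 2 ^ n) (\<delta> (Suc n)) (N n) (w n) (L n) (w (Suc n))"
      using exists_refining_walks[where \<delta> = \<delta> and \<epsilon> = "\<lambda>n. D / 2 ^ n" and K = K, OF assms(1,4) pos join]
      by (elim exE)
    have "0 < N n" for n using W by (metis less_zeroE neq0_conv)
    then have "\<exists>g. continuous_map (top_of_set {0..1}) mtopology g \<and>
        (\<forall>n. \<forall>i<N n. mball (w n i) (\<delta> n) \<subseteq> g ` cell (N n) i)"
      using W
      by (intro limit_of_refining_walks[OF compact_space_imp_mcomplete[OF assms(1)] D(1) le, of N L w]) auto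
    then obtain g where "continuous_map (top_of_set {0..1}) mtopology g"
      "\<forall>n. \<forall>i<N n. mball (w n i) (\<delta> n) \<subseteq> g ` cell (N n) i"
      by blast
    moreover have "w n i \<in> M" if "i < N n" for n i using W that by (simp add: walk_def)
    ultimately show ?thesis using W by (intro exI[of _ g] exI[of _ N]) blast
  qed
  moreover have "mball x (\<delta> 0) = M" if "x \<in> M" for x using ball_D[OF that] by (simp add: \<delta>_def)
  ultimately show ?thesis by (intro that[of \<delta>] pos)
qed

end

section \<open>A function that is nonconstant on every ball\<close>

text \<open>
  The identity theorem: an uncountable zero set in the unit disc would make the sum of the series
  vanish there, and hence all its coefficients.
\<close>
lemma countable_zeros_powser:
  fixes a :: "nat \<Rightarrow> complex"
  assumes bound: "\<And>n. norm (a n) \<le> B" and "a m \<noteq> 0"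
  shows "countable {z \<in> ball 0 1. (\<Sum>n. a n * z ^ n) = 0}"
proof (rule ccontr)
  define f where "f z = (\<Sum>n. a n * z ^ n)" for z
  assume unc: "\<not> countable {z \<in> ball 0 1. (\<Sum>n. a n * z ^ n) = 0}"
  have sums: "(\<lambda>n. a n * z ^ n) sums f z" if "norm z < 1" for z
  proof -
    have "summable (\<lambda>n. B * norm z ^ n)"
      using that by (intro summable_mult summable_geometric) simp
    then have "summable (\<lambda>n. a n * z ^ n)"
      by (rule summable_comparison_test'[where N = 0])
        (simp add: norm_mult norm_power bound mult_right_mono)
    then show ?thesis unfolding f_def by (rule summable_sums)
  qed
  have "f holomorphic_on ball 0 1"
    by (rule power_series_holomorphic[of _ _ a]) (use sums in auto)
  moreover have "fsigma (ball (0::complex) 1)"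
  proof -
    have "ball (0::complex) 1 = (\<Union>n. cball 0 (1 - 1 / real (Suc n)))"
    proof (intro equalityI subsetI)
      fix z :: complex assume "z \<in> ball 0 1"
      then have "0 < 1 - norm z" by simp
      then obtain n where "1 / real (Suc n) < 1 - norm z" using nat_approx_posE by blast
      then show "z \<in> (\<Union>n. cball 0 (1 - 1 / real (Suc n)))" by (intro UN_I[of n]) auto
    next
      fix z :: complex assume "z \<in> (\<Union>n. cball 0 (1 - 1 / real (Suc n)))"
      then obtain n where "norm z \<le> 1 - 1 / real (Suc n)" by auto
      moreover have "0 < 1 / real (Suc n)" by simp
      ultimately have "norm z < 1" by linarith
      then show "z \<in> ball 0 1" by simp
    qed
    then show ?thesis by (simp add: fsigma.intros)
  qed
  ultimately have "f constant_on ball 0 1"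
    using holomorphic_countable_zeros[of f "ball 0 1"] unc
    by (auto simp: f_def)
  moreover obtain z0 where "z0 \<in> ball 0 1" "f z0 = 0"
    using unc unfolding f_def by (metis (mono_tags, lifting) countable_empty empty_Collect_eq)
  ultimately have zero: "f z = 0" if "norm z < 1" for z
    using that unfolding constant_on_def by auto
  have "a 0 = 0"
    using sums[of 0] zero[of 0] powser_sums_zero[of a] sums_unique2 by fastforce
  then have "m > 0" using \<open>a m \<noteq> 0\<close> by (cases m) auto
  then obtain s where s: "0 < s" "\<And>z. z \<in> cball 0 s - {0} \<Longrightarrow> f z \<noteq> 0"
    using powser_0_nonzero[of 1 0 a f m] sums zero[of 0] \<open>a m \<noteq> 0\<close> by auto
  have "f (of_real (min s (1/2))) \<noteq> 0" using s by (intro s(2)) auto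
  moreover have "f (of_real (min s (1/2))) = 0" using s(1) by (intro zero) auto
  ultimately show False by blast
qed

context Metric_space
begin

text \<open>
  With \<open>a\<close> an enumeration of \<open>A\<close>, the functions \<open>x \<mapsto> \<Sum>k. d x (a k) * s ^ k\<close> for \<open>0 < s < 1\<close> are
  Lipschitz.  For distinct \<open>x\<close>, \<open>y\<close> in \<open>A\<close> the difference of the values at \<open>x\<close> and \<open>y\<close> is a power
  series in \<open>s\<close>, whose coefficient at the index of \<open>x\<close> is \<open>- d y x \<noteq> 0\<close>.  So each pair rules out only
  countably many \<open>s\<close>, and some \<open>s\<close> separates all pairs at once.
\<close>
lemma exists_Lipschitz_inj_on_countable:
  assumes "countable A" "A \<subseteq> M" and D: "\<And>x y. x \<in> M \<Longrightarrow> y \<in> M \<Longrightarrow> d x y \<le> D"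
  obtains h :: "'a \<Rightarrow> real" and C
  where "inj_on h A" "\<And>x y. x \<in> M \<Longrightarrow> y \<in> M \<Longrightarrow> \<bar>h x - h y\<bar> \<le> C * d x y"
proof (cases "A = {}")
  case True
  then show ?thesis using that[of "\<lambda>_. 0" 0] by simp
next
  case False
  define a where "a = from_nat_into A"
  have aA: "range a = A" unfolding a_def using range_from_nat_into[OF False \<open>countable A\<close>] .
  have aM: "a k \<in> M" for k using aA assms(2) by blast
  define Z where "Z x y = {z \<in> ball (0::complex) 1. (\<Sum>k. of_real (d x (a k) - d y (a k)) * z ^ k) = 0}" for x y
  have cZ: "countable (Z x y)" if xy: "x \<in> A" "y \<in> A" "x \<noteq> y" for x y
  proof -
    obtain k where k: "x = a k" using aA xy(1) by blast
    have "norm (of_real (d x (a j) - d y (a j)) :: complex) \<le> D" for j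
    proof -
      have "0 \<le> d x (a j)" "0 \<le> d y (a j)" "d x (a j) \<le> D" "d y (a j) \<le> D"
        using D xy aM assms(2) by auto
      then show ?thesis unfolding norm_of_real by linarith
    qed
    moreover have "(of_real (d x (a k) - d y (a k)) :: complex) \<noteq> 0"
      using k xy assms(2) aM zero[of y x] by auto
    ultimately show ?thesis unfolding Z_def by (rule countable_zeros_powser)
  qed
  have "countable (\<Union>(x, y) \<in> {(x, y) \<in> A \<times> A. x \<noteq> y}. Z x y)"
  proof (rule countable_UN)
    show "countable {(x, y) \<in> A \<times> A. x \<noteq> y}"
      by (rule countable_subset[OF _ countable_SIGMA[OF assms(1) assms(1)]]) blast
  qed (use cZ in auto)
  moreover have "\<not> countable (of_real ` {0<..<1::real} :: complex set)"
  proof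
    assume "countable (of_real ` {0<..<1::real} :: complex set)"
    then have "countable {0<..<1::real}" by (rule countable_image_inj_on) (auto simp: inj_on_def)
    then show False using uncountable_open_interval[of 0 "1::real"] by simp
  qed
  ultimately obtain s :: real where s: "0 < s" "s < 1"
    "\<And>x y. x \<in> A \<Longrightarrow> y \<in> A \<Longrightarrow> x \<noteq> y \<Longrightarrow> of_real s \<notin> Z x y"
  proof -
    assume *: thesis if "0 < s" "s < 1" "\<And>x y. x \<in> A \<Longrightarrow> y \<in> A \<Longrightarrow> x \<noteq> y \<Longrightarrow> of_real s \<notin> Z x y" for s :: real
    have "\<not> of_real ` {0<..<1::real} \<subseteq> (\<Union>(x, y) \<in> {(x, y) \<in> A \<times> A. x \<noteq> y}. Z x y)"
      using \<open>countable (\<Union>(x, y) \<in> {(x, y) \<in> A \<times> A. x \<noteq> y}. Z x y)\<close>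
        \<open>\<not> countable (of_real ` {0<..<1::real} :: complex set)\<close> countable_subset by blast
    then show thesis using * by fastforce
  qed
  define h where "h x = (\<Sum>k. d x (a k) * s ^ k)" for x
  have geo: "summable (\<lambda>k. c * s ^ k)" for c :: real
    using s by (intro summable_mult summable_geometric) simp
  have summ: "summable (\<lambda>k. d x (a k) * s ^ k)" if "x \<in> M" for x
    by (rule summable_comparison_test'[OF geo[of D], where N = 0])
      (use s D[OF that aM] in \<open>simp add: abs_mult mult_right_mono\<close>)
  have diff: "(\<lambda>k. (d x (a k) - d y (a k)) * s ^ k) sums (h x - h y)" if "x \<in> M" "y \<in> M" for x y
    using sums_diff[OF summable_sums[OF summ[OF that(1)]] summable_sums[OF summ[OF that(2)]]]
    by (simp add: h_def left_diff_distrib)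
  have "inj_on h A"
  proof (rule inj_onI, rule ccontr)
    fix x y assume xy: "x \<in> A" "y \<in> A" "h x = h y" "x \<noteq> y"
    then have "(\<lambda>k. (d x (a k) - d y (a k)) * s ^ k) sums 0" using diff[of x y] assms(2) by auto
    then have "(\<lambda>k. of_real ((d x (a k) - d y (a k)) * s ^ k) :: complex) sums of_real 0"
      by (rule sums_of_real)
    then have "(\<Sum>k. of_real (d x (a k) - d y (a k)) * of_real s ^ k :: complex) = 0"
      by (simp add: sums_iff)
    then have "of_real s \<in> Z x y" unfolding Z_def using s by simp
    then show False using s(3) xy by blast
  qed
  moreover have "\<bar>h x - h y\<bar> \<le> 1 / (1 - s) * d x y" if "x \<in> M" "y \<in> M" for x y
  proof -
    have "norm (\<Sum>k. (d x (a k) - d y (a k)) * s ^ k) \<le> (\<Sum>k. d x y * s ^ k)"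
    proof (rule norm_suminf_le[OF _ geo])
      fix k
      have "\<bar>d x (a k) - d y (a k)\<bar> \<le> d x y"
        using mdist_reverse_triangle[OF that(1) aM that(2)] commute by metis
      then show "norm ((d x (a k) - d y (a k)) * s ^ k) \<le> d x y * s ^ k"
        using s by (simp add: abs_mult mult_right_mono)
    qed
    also have "\<dots> = 1 / (1 - s) * d x y"
      using s by (simp add: suminf_mult suminf_geometric summable_geometric)
    finally show ?thesis using diff[OF that] by (simp add: sums_iff)
  qed
  ultimately show ?thesis using that by blast
qed

lemma compact_imp_countable_dense:
  assumes "compact_space mtopology"
  obtains A where "countable A" "A \<subseteq> M" "mtopology closure_of A = M"
proof -
  have "mtotally_bounded M"
    using assms compactin_imp_mtotally_bounded by (simp add: compact_space_def)
  then have "\<exists>K. finite K \<and> K \<subseteq> M \<and> M \<subseteq> (\<Union>x\<in>K. mball x (1 / real (Suc n)))" for n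
    unfolding mtotally_bounded_def by simp
  then obtain K where K: "\<And>n. finite (K n)" "\<And>n. K n \<subseteq> M"
    "\<And>n. M \<subseteq> (\<Union>x\<in>K n. mball x (1 / real (Suc n)))" by metis
  have "x \<in> mtopology closure_of (\<Union>n. K n)" if x: "x \<in> M" for x
    unfolding metric_closure_of
  proof (clarsimp simp: x)
    fix r :: real assume "0 < r"
    then obtain n where n: "1 / real (Suc n) < r" using nat_approx_posE by blast
    obtain z where "z \<in> K n" "x \<in> mball z (1 / real (Suc n))" using K(3)[of n] x by blast
    then show "\<exists>n. \<exists>y\<in>K n. y \<in> M \<and> d x y < r"
      using n commute by (intro exI[of _ n] bexI[of _ z]) auto
  qed
  moreover have "mtopology closure_of (\<Union>n. K n) \<subseteq> M"
    using closure_of_subset_topspace[of mtopology] by simp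
  ultimately have "mtopology closure_of (\<Union>n. K n) = M" by blast
  moreover have "countable (\<Union>n. K n)" by (rule countable_UN) (use K(1) countable_finite in auto)
  moreover have "(\<Union>n. K n) \<subseteq> M" using K(2) by blast
  ultimately show ?thesis using that by blast
qed

text \<open>
  A connected space with two points has no isolated point, so a nonempty open set stays nonempty
  when a point of the dense set is removed from it.
\<close>
lemma dense_meets_ball_twice:
  assumes "connected_space mtopology" "p \<in> M" "q \<in> M" "p \<noteq> q"
    and A: "mtopology closure_of A = M" and "x \<in> M" "0 < r"
  obtains u v where "u \<in> A \<inter> mball x r" "v \<in> A \<inter> mball x r" "u \<noteq> v"
proof -
  have dense: "A \<inter> T \<noteq> {}" if "openin mtopology T" "T \<noteq> {}" for T
    using A that dense_intersects_open[of mtopology A] by simp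
  obtain u where u: "u \<in> A" "u \<in> mball x r"
    using dense[of "mball x r"] assms(6,7) by (metis IntE centre_in_mball_iff equals0I openin_mball empty_iff)
  then have "u \<in> M" by simp
  have cl: "closedin mtopology {u}"
    using Hausdorff_space_mtopology \<open>u \<in> M\<close> by (simp add: closedin_Hausdorff_sing_eq)
  have "openin mtopology (mball x r - {u})" using cl by (simp add: openin_diff)
  moreover have "mball x r - {u} \<noteq> {}"
  proof
    assume "mball x r - {u} = {}"
    then have "openin mtopology {u}" using u(2) openin_mball[of x r] by (metis Diff_eq_empty_iff insert_subset subset_singleton_iff empty_iff)
    with cl have "{u} = M"
      using assms(1) unfolding connected_space_clopen_in by auto
    then show False using assms(2-4) by blast
  qed
  ultimately obtain v where "v \<in> A" "v \<in> mball x r - {u}" using dense by blast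
  then show ?thesis using u that[of u v] by blast
qed

text \<open>
  Every ball of radius \<open>\<delta>\<close> contains one of the finitely many balls of radius \<open>\<delta>/2\<close> around a
  \<open>\<delta>/2\<close>-net, so the least variation of \<open>h\<close> over the latter is a lower bound for all.
\<close>
lemma uniform_separation_in_balls:
  fixes h :: "'a \<Rightarrow> real"
  assumes "compact_space mtopology" "0 < \<delta>"
    and nonconst: "\<And>x r. x \<in> M \<Longrightarrow> 0 < r \<Longrightarrow> \<exists>u\<in>mball x r. \<exists>v\<in>mball x r. h u < h v"
  obtains \<omega> where "0 < \<omega>" "\<And>x. x \<in> M \<Longrightarrow> \<exists>u\<in>mball x \<delta>. \<exists>v\<in>mball x \<delta>. \<omega> \<le> h v - h u"
proof -
  have "mtotally_bounded M"
    using assms(1) compactin_imp_mtotally_bounded by (simp add: compact_space_def)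
  moreover have "0 < \<delta> / 2" using assms(2) by simp
  ultimately obtain K where K: "finite K" "K \<subseteq> M" "M \<subseteq> (\<Union>z\<in>K. mball z (\<delta> / 2))"
    unfolding mtotally_bounded_def by meson
  have "\<forall>z\<in>K. \<exists>u v. u \<in> mball z (\<delta> / 2) \<and> v \<in> mball z (\<delta> / 2) \<and> h u < h v"
    using nonconst[OF _ \<open>0 < \<delta> / 2\<close>] K(2) by blast
  then obtain u v where uv: "\<And>z. z \<in> K \<Longrightarrow> u z \<in> mball z (\<delta> / 2) \<and> v z \<in> mball z (\<delta> / 2) \<and> h (u z) < h (v z)"
    by metis
  define \<omega> where "\<omega> = Min (insert 1 ((\<lambda>z. h (v z) - h (u z)) ` K))"
  have "0 < \<omega>" unfolding \<omega>_def using K(1) uv by auto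
  moreover have "\<exists>u\<in>mball x \<delta>. \<exists>v\<in>mball x \<delta>. \<omega> \<le> h v - h u" if x: "x \<in> M" for x
  proof -
    obtain z where z: "z \<in> K" "x \<in> mball z (\<delta> / 2)" using K(3) x by blast
    have "mball z (\<delta> / 2) \<subseteq> mball x \<delta>" using z(2) by (intro mball_subset) auto
    moreover have "\<omega> \<le> h (v z) - h (u z)" unfolding \<omega>_def using K(1) z(1) by (intro Min_le) auto
    ultimately show ?thesis using uv[OF z(1)] by blast
  qed
  ultimately show ?thesis using that by blast
qed

text \<open>
  Since every ball contains two points of a dense set, a function that is injective on that set is
  nonconstant on every ball.  Its image is a compact interval, which an affine change of values turns into the unit interval.
\<close>
theorem exists_onto_unit_interval_nonconstant_on_balls:
  assumes "compact_space mtopology" "connected_space mtopology" "p \<in> M" "q \<in> M" "p \<noteq> q"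
  obtains h :: "'a \<Rightarrow> real" where "continuous_map mtopology euclideanreal h" "h ` M = {0..1}"
    "\<And>x r. x \<in> M \<Longrightarrow> 0 < r \<Longrightarrow> \<exists>u\<in>mball x r. \<exists>v\<in>mball x r. h u < h v"
proof -
  obtain A where A: "countable A" "A \<subseteq> M" "mtopology closure_of A = M"
    using compact_imp_countable_dense[OF assms(1)] by blast
  have "mbounded M" using assms(1) compactin_imp_mbounded by (simp add: compact_space_def)
  then obtain D where D: "\<And>x y. x \<in> M \<Longrightarrow> y \<in> M \<Longrightarrow> d x y \<le> D" unfolding mbounded_alt by blast
  obtain h0 :: "'a \<Rightarrow> real" and C where h0: "inj_on h0 A"
    "\<And>x y. x \<in> M \<Longrightarrow> y \<in> M \<Longrightarrow> \<bar>h0 x - h0 y\<bar> \<le> C * d x y"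
    using exists_Lipschitz_inj_on_countable[OF A(1,2) D] by blast
  have nonconst: "\<exists>u\<in>mball x r. \<exists>v\<in>mball x r. h0 u < h0 v" if x: "x \<in> M" and r: "0 < r" for x r
  proof -
    obtain u v where "u \<in> A \<inter> mball x r" "v \<in> A \<inter> mball x r" "u \<noteq> v"
      using dense_meets_ball_twice[OF assms(2-5) A(3) x r] by blast
    then show ?thesis using h0(1) by (metis IntE inj_onD linorder_neqE_linordered_idom)
  qed
  have "Lipschitz_continuous_map Self euclidean_metric h0"
    unfolding Lipschitz_continuous_map_def using h0(2) by (auto simp: dist_real_def)
  then have cont: "continuous_map mtopology euclideanreal h0"
    using Lipschitz_continuous_imp_continuous_map[of Self euclidean_metric h0]
    by (simp add: Self_def)
  have "connectedin euclideanreal (h0 ` M)" "compactin euclideanreal (h0 ` M)"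
    using connectedin_continuous_map_image[OF cont] image_compactin[OF _ cont] assms(1,2)
      connectedin_topspace[of mtopology]
    by (auto simp: compact_space_def)
  then obtain a b where ab: "h0 ` M = {a..b}"
    using connected_compact_interval_1[of "h0 ` M"] by auto
  have "a < b"
  proof -
    obtain u v where "u \<in> M" "v \<in> M" "h0 u < h0 v" using nonconst[OF assms(3), of 1] by auto
    then have "h0 u \<in> {a..b}" "h0 v \<in> {a..b}" "h0 u < h0 v" using ab by blast+
    then show ?thesis by auto
  qed
  define h where "h x = (h0 x - a) / (b - a)" for x
  show ?thesis
  proof (rule that)
    show "continuous_map mtopology euclideanreal h"
      unfolding h_def using cont \<open>a < b\<close>
      by (intro continuous_map_real_divide continuous_map_diff continuous_map_const[THEN iffD2]) auto
    have "h ` M = (\<lambda>t. (t - a) / (b - a)) ` (h0 ` M)" by (simp add: h_def image_image)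
    also have "\<dots> = {0..1}"
    proof
      show "{0..1} \<subseteq> (\<lambda>t. (t - a) / (b - a)) ` (h0 ` M)"
      proof
        fix s :: real assume "s \<in> {0..1}"
        define r where "r = s * (b - a)"
        have "0 \<le> r" "r \<le> b - a"
          using \<open>s \<in> {0..1}\<close> \<open>a < b\<close> mult_right_mono[of s 1 "b - a"] by (auto simp: r_def)
        then have "a + r \<in> h0 ` M" using ab by auto
        moreover have "s = (a + r - a) / (b - a)" using \<open>a < b\<close> by (simp add: r_def)
        ultimately show "s \<in> (\<lambda>t. (t - a) / (b - a)) ` (h0 ` M)" by blast
      qed
    qed (use \<open>a < b\<close> ab in auto)
    finally show "h ` M = {0..1}" .
    show "\<exists>u\<in>mball x r. \<exists>v\<in>mball x r. h u < h v" if "x \<in> M" "0 < r" for x r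
    proof -
      have "h u < h v" if "h0 u < h0 v" for u v
        unfolding h_def using that \<open>a < b\<close> by (intro divide_strict_right_mono) auto
      then show ?thesis using nonconst[OF that] by blast
    qed
  qed
qed

end

section \<open>Expansion of cells and chaos\<close>

lemma cell_within_interval:
  assumes "0 \<le> a" "b \<le> 1" "2 / real N \<le> b - a" "0 < N"
  obtains i where "i < N" "cell N i \<subseteq> {a..b}"
proof
  define i where "i = nat \<lceil>a * real N\<rceil>"
  have "0 \<le> a * real N" using assms by simp
  then have i: "a * real N \<le> real i" "real i < a * real N + 1"
    unfolding i_def by linarith+
  have "2 \<le> (b - a) * real N" using assms(3,4) by (simp add: field_simps)
  then have ib: "real i + 1 \<le> b * real N" using i(2) by (simp add: algebra_simps)
  also have "b * real N \<le> real N" using assms by (simp add: mult_left_le_one_le mult_le_cancel_right1)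
  finally show "i < N" by linarith
  show "cell N i \<subseteq> {a..b}"
    unfolding cell_def atLeastatMost_subset_iff using i(1) ib assms(4) by (simp add: field_simps)
qed

lemma cell_in_neighbourhood:
  assumes "t \<in> {0..1}" "0 < N" "1 / real N < r"
  obtains i where "i < N" "cell N i \<subseteq> {0..1} \<inter> ball t r"
proof -
  have "\<exists>i<N. t \<in> cell N i"
  proof (cases "t = 1")
    case True
    then show ?thesis
      using assms(2) by (intro exI[of _ "N - 1"]) (auto simp: cell_def of_nat_diff)
  next
    case False
    have "t * real N < real N" using False assms by simp
    moreover have "0 \<le> t * real N" using assms by simp
    ultimately have "nat \<lfloor>t * real N\<rfloor> < N" "real (nat \<lfloor>t * real N\<rfloor>) \<le> t * real N"
      "t * real N \<le> real (nat \<lfloor>t * real N\<rfloor>) + 1" by linarith+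
    then show ?thesis
      using assms(2) by (intro exI[of _ "nat \<lfloor>t * real N\<rfloor>"]) (simp add: cell_def field_simps)
  qed
  then obtain i where i: "i < N" "t \<in> cell N i" by blast
  have "cell N i \<subseteq> ball t r"
  proof
    fix s assume "s \<in> cell N i"
    then have "\<bar>t - s\<bar> \<le> (real i + 1) / real N - real i / real N" using i(2) by (auto simp: cell_def)
    also have "\<dots> = 1 / real N" using assms(2) by (simp add: field_simps)
    finally show "s \<in> ball t r" using assms(3) by (simp add: dist_real_def)
  qed
  then show ?thesis using that i(1) cell_subset_unit[OF i(1)] by blast
qed

lemma fixed_point_if_image_covers:
  fixes f :: "real \<Rightarrow> real"
  assumes "a \<le> b" "continuous_on {a..b} f" "{a..b} \<subseteq> f ` {a..b}"
  obtains t where "t \<in> {a..b}" "f t = t"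
proof -
  obtain u v where uv: "u \<in> {a..b}" "f u = a" "v \<in> {a..b}" "f v = b"
    using assms(1,3) by (metis atLeastAtMost_iff imageE order_refl subset_iff)
  have "connected ((\<lambda>t. f t - t) ` {a..b})"
    by (intro connected_continuous_image continuous_intros assms(2)) simp
  moreover have "f u - u \<in> (\<lambda>t. f t - t) ` {a..b}" "f v - v \<in> (\<lambda>t. f t - t) ` {a..b}"
    using uv by blast+
  ultimately have "0 \<in> (\<lambda>t. f t - t) ` {a..b}"
    using uv connectedD_interval[of _ "f u - u" "f v - v" 0] by auto
  then show ?thesis using that by auto
qed

context Metric_space
begin

text \<open>
  An interval of two cell lengths contains a full cell wherever it lies; this is why \<open>expand\<close> has the
  factor \<open>2\<close>.  Cells are followed from level \<open>n\<close> to level \<open>0\<close>, one application of \<open>h \<circ> g\<close> per level.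
\<close>
lemma exact_devaney_if_cells_expand:
  assumes g: "continuous_map (top_of_set {0..1}) mtopology g"
    and h: "continuous_map mtopology euclideanreal h" "h ` M = {0..1}"
    and N: "\<And>n. n < N n"
    and first: "\<And>i. i < N 0 \<Longrightarrow> g ` cell (N 0) i = M"
    and expand: "\<And>n i. i < N (Suc n) \<Longrightarrow>
      \<exists>s \<in> cell (N (Suc n)) i. \<exists>t \<in> cell (N (Suc n)) i. 2 / real (N n) \<le> h (g t) - h (g s)"
  shows "continuous_map mtopology mtopology (g \<circ> h) \<and> exact_map mtopology (g \<circ> h) \<and>
    devaney_chaotic mtopology (g \<circ> h)"
proof -
  define f where "f = g \<circ> h"
  define F where "F = h \<circ> g"
  have Npos: "0 < N n" for n using N[of n] by simp
  have hI: "h x \<in> {0..1}" if "x \<in> M" for x using that h(2) by blast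
  have gM: "g t \<in> M" if "t \<in> {0..1}" for t
    using continuous_map_image_subset_topspace[OF g] that by auto
  have contF: "continuous_on {0..1} F"
    using continuous_map_compose[OF g h(1)] by (simp add: F_def)
  have FI: "F t \<in> {0..1}" if "t \<in> {0..1}" for t using gM[OF that] hI by (simp add: F_def)
  have FnI: "(F ^^ n) t \<in> {0..1}" if "t \<in> {0..1}" for t n
    using that FI by (induction n) auto
  have contFn: "continuous_on {0..1} (F ^^ n)" for n
  proof (induction n)
    case (Suc n)
    then show ?case
      using continuous_on_compose2[OF contF Suc] FnI by (simp add: o_def image_subset_iff)
  qed (simp add: id_def)
  have conj: "(f ^^ n) (g t) = g ((F ^^ n) t)" for n t
    by (induction n) (simp, simp add: f_def[THEN fun_cong] F_def[THEN fun_cong])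
  have contf: "continuous_map mtopology mtopology f"
  proof -
    have "continuous_map mtopology (top_of_set {0..1}) h"
      unfolding continuous_map_in_subtopology topspace_mtopology using h(1) hI by blast
    then show ?thesis unfolding f_def by (rule continuous_map_compose[OF _ g])
  qed
  have fM: "(f ^^ n) x \<in> M" if "x \<in> M" for x n
  proof (induction n)
    case (Suc n)
    then show ?case using gM[OF hI] by (simp add: f_def[THEN fun_cong])
  qed (use that in simp)
  have pull: "\<exists>k < N n. cell (N n) k \<subseteq> F ` cell (N (Suc n)) i" if i: "i < N (Suc n)" for n i
  proof -
    let ?J = "cell (N (Suc n)) i"
    obtain s t where st: "s \<in> ?J" "t \<in> ?J" "2 / real (N n) \<le> F t - F s"
      using expand[OF i] unfolding F_def comp_def by blast
    have J: "?J \<subseteq> {0..1}" by (rule cell_subset_unit[OF i])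
    have "F s \<in> {0..1}" "F t \<in> {0..1}" using FI J st by blast+
    then have "0 \<le> F s" "F t \<le> 1" by auto
    from cell_within_interval[OF this st(3) Npos]
    obtain k where k: "k < N n" "cell (N n) k \<subseteq> {F s..F t}" by blast
    have "connected (F ` ?J)"
      by (rule connected_continuous_image[OF continuous_on_subset[OF contF J]]) (simp add: cell_def)
    then have "{F s..F t} \<subseteq> F ` ?J" using st by (intro connected_contains_Icc) auto
    then show ?thesis using k by blast
  qed
  have pull_to_first: "\<exists>k < N 0. cell (N 0) k \<subseteq> (F ^^ n) ` cell (N n) i" if "i < N n" for n i
    using that
  proof (induction n arbitrary: i)
    case (Suc n)
    obtain j where j: "j < N n" "cell (N n) j \<subseteq> F ` cell (N (Suc n)) i" using pull[OF Suc.prems] by blast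
    obtain k where k: "k < N 0" "cell (N 0) k \<subseteq> (F ^^ n) ` cell (N n) j" using Suc.IH[OF j(1)] by blast
    have "(F ^^ n) ` cell (N n) j \<subseteq> (F ^^ n) ` F ` cell (N (Suc n)) i" using j(2) by (rule image_mono)
    also have "\<dots> = (F ^^ Suc n) ` cell (N (Suc n)) i"
      by (simp only: funpow_Suc_right image_comp)
    finally show ?case using k by blast
  qed auto
  have onto: "M \<subseteq> g ` (F ^^ n) ` cell (N n) i" if "i < N n" for n i
    using pull_to_first[OF that] first image_mono[of _ _ g] by metis
  have gsurj: "g ` {0..1} = M"
    using first[OF Npos] cell_subset_unit[OF Npos] gM by blast
  have localize: "\<exists>n. \<exists>i < N n. cell (N n) i \<subseteq> {0..1} \<and> g ` cell (N n) i \<subseteq> U"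
    if U: "openin mtopology U" "U \<noteq> {}" for U
  proof -
    have "U \<subseteq> M" using openin_subset[OF U(1)] by simp
    then obtain t where t: "t \<in> {0..1}" "g t \<in> U" using U(2) gsurj by blast
    have "openin (top_of_set {0..1}) {s \<in> {0..1}. g s \<in> U}"
      using openin_continuous_map_preimage[OF g U(1)] by simp
    then obtain r where r: "0 < r" "ball t r \<inter> {0..1} \<subseteq> {s \<in> {0..1}. g s \<in> U}"
      using t unfolding openin_contains_ball by blast
    obtain n where "1 / real (Suc n) < r" using nat_approx_posE[OF r(1)] by blast
    moreover have "1 / real (N (Suc n)) \<le> 1 / real (Suc n)"
      using N[of "Suc n"] by (intro divide_left_mono) auto
    ultimately have "1 / real (N (Suc n)) < r" by simp
    from cell_in_neighbourhood[OF t(1) Npos this]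
    obtain i where i: "i < N (Suc n)" "cell (N (Suc n)) i \<subseteq> {0..1} \<inter> ball t r" by blast
    then have "g ` cell (N (Suc n)) i \<subseteq> U" using r(2) by blast
    then show ?thesis using i by blast
  qed
  have exact: "\<exists>n. (f ^^ n) ` U = M" if U: "openin mtopology U" "U \<noteq> {}" for U
  proof -
    obtain n i where i: "i < N n" "g ` cell (N n) i \<subseteq> U" using localize[OF U] by blast
    have "M \<subseteq> (f ^^ n) ` g ` cell (N n) i"
      using onto[OF i(1)] by (simp add: image_image conj)
    also have "\<dots> \<subseteq> (f ^^ n) ` U" using i(2) by (rule image_mono)
    finally have "M \<subseteq> (f ^^ n) ` U" .
    moreover have "(f ^^ n) ` U \<subseteq> M" using fM openin_subset[OF U(1)] by auto
    ultimately show ?thesis by blast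
  qed
  have periodic: "\<exists>x \<in> U. \<exists>n>0. (f ^^ n) x = x" if U: "openin mtopology U" "U \<noteq> {}" for U
  proof -
    obtain n i where i: "i < N n" "g ` cell (N n) i \<subseteq> U" using localize[OF U] by blast
    let ?J = "cell (N n) i"
    have J: "?J \<subseteq> {0..1}" by (rule cell_subset_unit[OF i(1)])
    have "{0..1} \<subseteq> h ` g ` (F ^^ n) ` ?J" 
      using image_mono[OF onto[OF i(1)], of h] unfolding h(2) .
    also have "\<dots> = (F ^^ Suc n) ` ?J"
      by (simp only: F_def funpow.simps image_comp o_assoc)
    finally have "?J \<subseteq> (F ^^ Suc n) ` ?J" using J by blast
    moreover have "continuous_on ?J (F ^^ Suc n)" by (rule continuous_on_subset[OF contFn J])
    moreover have "real i / real (N n) \<le> (real i + 1) / real (N n)" by (simp add: divide_right_mono)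
    ultimately obtain t where t: "t \<in> ?J" "(F ^^ Suc n) t = t"
      unfolding cell_def using fixed_point_if_image_covers by blast
    then have "(f ^^ Suc n) (g t) = g t" by (simp only: conj)
    then show ?thesis using t(1) i(2) by blast
  qed
  have "transitive_map mtopology f"
    unfolding transitive_map_def
  proof (intro conjI allI impI contf)
    fix U V assume UV: "openin mtopology U \<and> U \<noteq> {} \<and> openin mtopology V \<and> V \<noteq> {}"
    then obtain n where "(f ^^ n) ` U = M" using exact by blast
    moreover have "V \<subseteq> M" using UV openin_subset by fastforce
    ultimately show "\<exists>n. (f ^^ n) ` U \<inter> V \<noteq> {}" using UV by (intro exI[of _ n]) blast
  qed
  moreover have "mtopology closure_of (periodic_points mtopology f) = M"
  proof -
    have "periodic_points mtopology f \<inter> U \<noteq> {}" if U: "openin mtopology U" "U \<noteq> {}" for U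
      using periodic[OF U] openin_subset[OF U(1)] by (auto simp: periodic_points_def)
    then show ?thesis using dense_intersects_open[of mtopology "periodic_points mtopology f"] by simp
  qed
  ultimately show ?thesis
    using contf exact by (simp add: devaney_chaotic_def exact_map_def flip: f_def)
qed

text \<open>
  The choices are made in the order \<open>\<delta>\<close>, \<open>h\<close>, \<open>\<omega>\<close>, and only then \<open>N\<close> and \<open>g\<close>.
\<close>
theorem peano_continuum_exact_devaney:
  assumes "compact_space mtopology" "connected_space mtopology" "locally_connected_space mtopology"
    and pq: "p \<in> M" "q \<in> M" "p \<noteq> q"
  shows "\<exists>f. continuous_map mtopology mtopology f \<and> exact_map mtopology f \<and> devaney_chaotic mtopology f"
proof -
  obtain \<delta> :: "nat \<Rightarrow> real" where \<delta>: "\<And>n. 0 < \<delta> n" "\<And>x. x \<in> M \<Longrightarrow> mball x (\<delta> 0) = M"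
    and param: "\<And>K. \<exists>g N. continuous_map (top_of_set {0..1}) mtopology g \<and> (\<forall>n. K n < N n) \<and>
       (\<forall>n. \<forall>i<N n. \<exists>x\<in>M. mball x (\<delta> n) \<subseteq> g ` cell (N n) i)"
    using cellwise_open_parametrization[OF assms(1-3)] pq(1) by blast
  obtain h :: "'a \<Rightarrow> real" where h: "continuous_map mtopology euclideanreal h" "h ` M = {0..1}"
    "\<And>x r. x \<in> M \<Longrightarrow> 0 < r \<Longrightarrow> \<exists>u\<in>mball x r. \<exists>v\<in>mball x r. h u < h v"
    using exists_onto_unit_interval_nonconstant_on_balls[OF assms(1,2) pq] by blast
  have "\<exists>\<omega>>0. \<forall>x\<in>M. \<exists>u\<in>mball x (\<delta> (Suc n)). \<exists>v\<in>mball x (\<delta> (Suc n)). \<omega> \<le> h v - h u" for n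
    using uniform_separation_in_balls[OF assms(1) \<delta>(1) h(3), of "Suc n"] by metis
  then obtain \<omega> where \<omega>: "\<And>n. 0 < \<omega> n" "\<And>n x. x \<in> M \<Longrightarrow>
      \<exists>u\<in>mball x (\<delta> (Suc n)). \<exists>v\<in>mball x (\<delta> (Suc n)). \<omega> n \<le> h v - h u"
    by metis
  \<comment> \<open>The first bound makes the cells shrink, the second makes them small compared with \<open>\<omega> n\<close>.\<close>
  define K where "K n = max n (nat \<lceil>2 / \<omega> n\<rceil>)" for n
  obtain g N where g: "continuous_map (top_of_set {0..1}) mtopology g" and N: "\<And>n. K n < N n"
    and cover: "\<And>n i. i < N n \<Longrightarrow> \<exists>x\<in>M. mball x (\<delta> n) \<subseteq> g ` cell (N n) i"
    using param[of K] by blast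
  have gM: "g t \<in> M" if "t \<in> {0..1}" for t
    using continuous_map_image_subset_topspace[OF g] that by auto
  have "continuous_map mtopology mtopology (g \<circ> h) \<and> exact_map mtopology (g \<circ> h) \<and>
    devaney_chaotic mtopology (g \<circ> h)"
  proof (rule exact_devaney_if_cells_expand[OF g h(1,2)])
    show "n < N n" for n using N[of n] by (simp add: K_def)
    show "g ` cell (N 0) i = M" if "i < N 0" for i
      using cover[OF that] \<delta>(2) cell_subset_unit[OF that] gM by blast
    show "\<exists>s \<in> cell (N (Suc n)) i. \<exists>t \<in> cell (N (Suc n)) i. 2 / real (N n) \<le> h (g t) - h (g s)"
      if i: "i < N (Suc n)" for n i
    proof -
      have "2 / \<omega> n < real (N n)" using N[of n] unfolding K_def by linarith
      moreover from this have "0 < real (N n)" using \<omega>(1)[of n] by (smt (verit) divide_pos_pos)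
      ultimately have le: "2 / real (N n) \<le> \<omega> n" using \<omega>(1)[of n] by (simp add: field_simps)
      obtain x where x: "x \<in> M" "mball x (\<delta> (Suc n)) \<subseteq> g ` cell (N (Suc n)) i" using cover[OF i] by blast
      obtain u v where uv: "u \<in> mball x (\<delta> (Suc n))" "v \<in> mball x (\<delta> (Suc n))" "\<omega> n \<le> h v - h u"
        using \<omega>(2)[OF x(1)] by blast
      obtain s where s: "s \<in> cell (N (Suc n)) i" "u = g s" using x(2) uv(1) by blast
      obtain t where t: "t \<in> cell (N (Suc n)) i" "v = g t" using x(2) uv(2) by blast
      have "2 / real (N n) \<le> h (g t) - h (g s)" using order_trans[OF le uv(3)] unfolding s(2) t(2) .
      then show ?thesis using s(1) t(1) by blast
    qed
  qed
  then show ?thesis by blast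
qed

end

theorem theorem1:
  fixes X :: "'a topology"
  assumes "peano_continuum X"
  shows "\<exists>f. continuous_map X X f \<and> exact_map X f \<and> devaney_chaotic X f"
proof (cases "\<exists>p q. p \<in> topspace X \<and> q \<in> topspace X \<and> p \<noteq> q")
  case True
  then obtain p q where pq: "p \<in> topspace X" "q \<in> topspace X" "p \<noteq> q" by blast
  have X: "compact_space X" "connected_space X" "locally_connected_space X" "metrizable_space X"
    using assms by (auto simp: peano_continuum_def continuum_def)
  then obtain M d where "Metric_space M d" and X_eq: "X = Metric_space.mtopology M d"
    unfolding metrizable_space_def by blast
  interpret Metric_space M d by fact
  show ?thesis
    using peano_continuum_exact_devaney[of p q] X(1-3) pq unfolding X_eq by simp
next
  case False
  then have trivial: "U = topspace X" if "openin X U" "U \<noteq> {}" for U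
    using openin_subset[OF that(1)] that(2) by blast
  have "(id ^^ 0) ` U = topspace X" if "openin X U" "U \<noteq> {}" for U
    using trivial[OF that] by simp
  then have "exact_map X id"
    unfolding exact_map_def by (intro conjI continuous_map_id allI impI exI[of _ 0]) auto
  moreover have "(id ^^ 0) ` U \<inter> V \<noteq> {}"
    if "openin X U \<and> U \<noteq> {} \<and> openin X V \<and> V \<noteq> {}" for U V
    using that trivial[of U] trivial[of V] by simp
  then have "transitive_map X id"
    unfolding transitive_map_def by (intro conjI continuous_map_id allI impI exI[of _ 0]) auto
  moreover have "periodic_points X id = topspace X"
    unfolding periodic_points_def by auto
  ultimately show ?thesis
    by (intro exI[of _ id]) (simp add: devaney_chaotic_def)
qed

end
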